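(* Let $g(x), f(x) \in \mathcal{F}_0$, and let $M(g,f)$ be the infinite matrix with bivariate generating function $$B(x,y)=\frac{g(x)}{(1-x)(1+yx)}+\frac{xf(x)}{(1-x^2)(1-yx)}.$$ Then $M(g,f)$ is the Sprugnoli array $$(G, F_1, F_2)=\left(\frac{g(x)}{1-x}+\frac{xf(x)}{1-x^2},\ \frac{x\left(xf(x)-(1+x)g(x)\right)}{xf(x)+(1+x)g(x)},\ x\right).$$
   Context: All power series are formal power series with coefficients in $\mathbb{C}$. For $r\ge 0$, $\mathcal{F}_r=\{\sum_{n\ge r} a_n x^n \in \mathbb{C}[[x]] : a_r\neq 0\}$. The bivariate generating function of an infinite matrix $(t_{n,k})_{n,k\ge 0}$ is $\sum_{n,k\ge 0} t_{n,k}x^n y^k$, and $[x^n]$ denotes extraction of the coefficient of $x^n$. A Sprugnoli array is a triple $(G,F_1,F_2)$ with $G\in\mathcal{F}_0$, $F_1\in\mathcal{F}_1$, and $F_2\in\mathcal{F}_1$ an odd power series (that is, $F_2\in x\mathbb{C}[[x^2]]$). It is identified with the lower-triangular infinite matrix $(t_{n,k})_{n,k\ge 0}$ given by $$t_{n,k}=[x^n]\,G(x)\,F_1(x)^{k \bmod 2}\,(xF_2(x))^{\lfloor k/2\rfloor}.$$ *)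

theory Defs
  imports Complex_Main "HOL-Computational_Algebra.Formal_Power_Series"
begin

definition fps_class :: "nat \<Rightarrow> complex fps set" where
  "fps_class r = {a. (\<forall>n<r. fps_nth a n = 0) \<and> fps_nth a r \<noteq> 0}"

definition odd_fps :: "complex fps \<Rightarrow> bool" where
  "odd_fps a \<longleftrightarrow> (\<exists>h. a = fps_X * fps_compose h (fps_X ^ 2))"

definition sprugnoli_array :: "complex fps \<Rightarrow> complex fps \<Rightarrow> complex fps \<Rightarrow> bool" where
  "sprugnoli_array G F1 F2 \<longleftrightarrow>
     G \<in> fps_class 0 \<and> F1 \<in> fps_class 1 \<and> F2 \<in> fps_class 1 \<and> odd_fps F2"

definition sprugnoli_matrix ::
  "complex fps \<Rightarrow> complex fps \<Rightarrow> complex fps \<Rightarrow> nat \<Rightarrow> nat \<Rightarrow> complex" where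
  "sprugnoli_matrix G F1 F2 n k =
     fps_nth (G * F1 ^ (k mod 2) * (fps_X * F2) ^ (k div 2)) n"

text \<open>
  A bivariate series in \<open>x\<close> and \<open>y\<close> is represented in \<open>\<complex>[[x]][[y]]\<close>: the outer indeterminate
  is \<open>y\<close>, and the coefficient of \<open>y ^ k\<close> is a series in \<open>x\<close>.
\<close>

definition var_x :: "complex fps fps" where
  "var_x = fps_const fps_X"

definition var_y :: "complex fps fps" where
  "var_y = fps_X"

definition bivariate_gf :: "(nat \<Rightarrow> nat \<Rightarrow> complex) \<Rightarrow> complex fps fps" where
  "bivariate_gf t = Abs_fps (\<lambda>k. Abs_fps (\<lambda>n. t n k))"

lemma bij_bivariate_gf: "bij bivariate_gf"
proof (rule bijI')
  show "bivariate_gf s = bivariate_gf t \<longleftrightarrow> s = t" for s t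
    by (auto simp: bivariate_gf_def fps_eq_iff fun_eq_iff)
  show "\<exists>t. B = bivariate_gf t" for B
    by (rule exI[of _ "\<lambda>n k. fps_nth (fps_nth B k) n"])
       (simp add: bivariate_gf_def fps_eq_iff)
qed

text \<open>
  Division on \<^typ>\<open>complex fps fps\<close> is a total operation over a coefficient ring that is not a
  field. The two denominators below are units, and for them it is the ring-theoretic quotient
  (lemma \<open>B_gf_quotients\<close>).
\<close>

definition B_gf :: "complex fps \<Rightarrow> complex fps \<Rightarrow> complex fps fps" where
  "B_gf g f =
     fps_const g / ((1 - var_x) * (1 + var_y * var_x)) +
     var_x * fps_const f / ((1 - var_x ^ 2) * (1 - var_y * var_x))"

lemma fps_fps_divide_mult_cancel:
  fixes a d :: "complex fps fps"
  assumes "fps_nth (fps_nth d 0) 0 \<noteq> 0"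
  shows "a / d * d = a"
proof -
  have nz: "fps_nth d 0 \<noteq> 0"
    using assms by auto
  have "fps_nth d 0 * inverse (fps_nth d 0) = 1"
    using inverse_mult_eq_1[OF assms] by (simp add: mult.commute)
  then have "d * inverse d = 1"
    using fps_right_inverse[of d "inverse (fps_nth d 0)"] by (simp add: fps_inverse_def)
  then show ?thesis
    by (simp add: fps_divide_unit[OF nz] mult.assoc mult.commute[of _ d])
qed

lemma B_gf_quotients:
  fixes a :: "complex fps fps"
  shows "a / ((1 - var_x) * (1 + var_y * var_x)) * ((1 - var_x) * (1 + var_y * var_x)) = a"
    and "a / ((1 - var_x ^ 2) * (1 - var_y * var_x)) *
           ((1 - var_x ^ 2) * (1 - var_y * var_x)) = a"
  by (rule fps_fps_divide_mult_cancel, simp add: var_x_def var_y_def)+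

end

theory Submission
  imports Defs
begin

text \<open>
  Write \<open>w\<^sub>+ = x f + (1 + x) g\<close> and \<open>w\<^sub>- = x f - (1 + x) g\<close>. Expanding both summands of \<open>B(x, y)\<close> as
  geometric series in \<open>y\<close>, with ratios \<open>-x\<close> and \<open>x\<close>, gives for the generating function of column \<open>k\<close>
  \<open>(-x) ^ k g / (1 - x) + x ^ k x f / (1 - x\<^sup>2) = x ^ k (x f + (-1) ^ k (1 + x) g) / (1 - x\<^sup>2)\<close>,
  which is \<open>x ^ k w\<^sub>+ / (1 - x\<^sup>2)\<close> for even \<open>k\<close> and \<open>x ^ k w\<^sub>- / (1 - x\<^sup>2)\<close> for odd \<open>k\<close>. On the other
  side \<open>G = w\<^sub>+ / (1 - x\<^sup>2)\<close> and \<open>F\<^sub>1 = x w\<^sub>- / w\<^sub>+\<close>, so that \<open>G F\<^sub>1 = x w\<^sub>- / (1 - x\<^sup>2)\<close>; multiplying by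
  \<open>(x \<cdot> x) ^ (k div 2)\<close> produces the same columns. Since \<open>w\<^sub>+\<close> and \<open>w\<^sub>-\<close> have constant terms
  \<open>g(0)\<close> and \<open>-g(0)\<close>, the series \<open>G\<close> and \<open>F\<^sub>1\<close> have orders 0 and 1.
\<close>

unbundle fps_syntax

text \<open>
  The product telescopes: multiplication by \<open>c y\<close> shifts the geometric series by one place and leaves
  only its constant term in the difference.
\<close>

lemma geometric_fps_mult:
  fixes c :: "'a::comm_ring_1"
  shows "Abs_fps (\<lambda>k. c ^ k) * (1 - fps_X * fps_const c) = 1"
proof (rule fps_ext)
  fix k
  have "Abs_fps (\<lambda>k. c ^ k) * (1 - fps_X * fps_const c) =
      Abs_fps (\<lambda>k. c ^ k) - fps_X * (fps_const c * Abs_fps (\<lambda>k. c ^ k))"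
    by (simp only: right_diff_distrib mult_1_left mult_1_right mult_ac)
  then show "(Abs_fps (\<lambda>k. c ^ k) * (1 - fps_X * fps_const c)) $ k = (1 :: 'a fps) $ k"
    by (cases k) simp_all
qed

text \<open>
  For suitable \<open>a\<close>, \<open>e\<close> and \<open>c\<close> the left-hand side is a summand of \<open>B\<close>. The total division on \<open>\<complex>[[x]][[y]]\<close> is the true quotient here
  because the denominator is a unit, so both sides can be compared after multiplying by it.
\<close>

lemma fps_const_divide_geometric:
  fixes a c e :: "complex fps"
  assumes "e $ 0 \<noteq> 0"
  shows "fps_const a / (fps_const e * (1 - fps_X * fps_const c)) = Abs_fps (\<lambda>k. a / e * c ^ k)"
    (is "?q = ?s")
proof -
  let ?d = "fps_const e * (1 - fps_X * fps_const c)"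
  have unit: "?d $ 0 $ 0 \<noteq> 0"
    using assms by simp
  have "a / e * e = a"
    using assms by (simp add: fps_divide_unit mult.assoc inverse_mult_eq_1)
  have "?s = fps_const (a / e) * Abs_fps (\<lambda>k. c ^ k)"
    by (rule fps_ext) simp
  then have "?s * ?d =
      fps_const (a / e * e) * (Abs_fps (\<lambda>k. c ^ k) * (1 - fps_X * fps_const c))"
    by (simp only: fps_const_mult[symmetric] mult_ac)
  also have "\<dots> = ?q * ?d"
    by (simp only: geometric_fps_mult \<open>a / e * e = a\<close> fps_fps_divide_mult_cancel[OF unit]) simp
  finally have "?s * ?d = ?q * ?d" .
  moreover have "?d \<noteq> 0"
    using unit by fastforce
  ultimately show ?thesis
    by simp
qed

lemma B_gf_column:
  "B_gf g f $ k = g / (1 - fps_X) * (- fps_X) ^ k + fps_X * f / (1 - fps_X ^ 2) * fps_X ^ k"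
proof -
  have "fps_const g / ((1 - var_x) * (1 + var_y * var_x)) =
      Abs_fps (\<lambda>k. g / (1 - fps_X) * (- fps_X) ^ k)"
    \<comment> \<open>\<open>1 + y x\<close> is \<open>1 - y c\<close> with \<open>c = -x\<close>; this sign separates odd columns from even ones.\<close>
    using fps_const_divide_geometric[of "1 - fps_X" g "- fps_X"]
    by (simp add: var_x_def var_y_def flip: fps_const_sub fps_const_neg)
  moreover have "var_x * fps_const f / ((1 - var_x ^ 2) * (1 - var_y * var_x)) =
      Abs_fps (\<lambda>k. fps_X * f / (1 - fps_X ^ 2) * fps_X ^ k)"
    using fps_const_divide_geometric[of "1 - fps_X ^ 2" "fps_X * f" fps_X]
    by (simp add: var_x_def var_y_def flip: fps_const_sub)
  ultimately show ?thesis
    by (simp add: B_gf_def)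
qed

text \<open>Brings both summands of \<open>G\<close> over the common denominator \<open>1 - x\<^sup>2\<close>.\<close>

lemma divide_one_minus_X:
  fixes g :: "'a::field fps"
  shows "g / (1 - fps_X) = (1 + fps_X) * g / (1 - fps_X ^ 2)"
proof -
  have factor: "1 - fps_X ^ 2 = (1 - fps_X) * (1 + fps_X :: 'a fps)"
    by (simp add: power2_eq_square algebra_simps)
  have "(1 + fps_X :: 'a fps) $ 0 \<noteq> 0"
    by simp
  then have "(1 + fps_X :: 'a fps) \<noteq> 0"
    by fastforce
  then show ?thesis
    unfolding factor by (simp add: mult.commute[of "1 + fps_X"])
qed

theorem proposition8:
  fixes g f :: "complex fps" and M :: "nat \<Rightarrow> nat \<Rightarrow> complex"
  assumes "g \<in> fps_class 0" and "f \<in> fps_class 0"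
    and "bivariate_gf M = B_gf g f"
  shows "sprugnoli_array
           (g / (1 - fps_X) + fps_X * f / (1 - fps_X ^ 2))
           (fps_X * (fps_X * f - (1 + fps_X) * g) / (fps_X * f + (1 + fps_X) * g))
           fps_X \<and>
         M = sprugnoli_matrix
           (g / (1 - fps_X) + fps_X * f / (1 - fps_X ^ 2))
           (fps_X * (fps_X * f - (1 + fps_X) * g) / (fps_X * f + (1 + fps_X) * g))
           fps_X"
proof -
  define wp where "wp = fps_X * f + (1 + fps_X) * g"
  define wm where "wm = fps_X * f - (1 + fps_X) * g"
  define v :: "complex fps" where "v = inverse (1 - fps_X ^ 2)"
  define G where "G = g / (1 - fps_X) + fps_X * f / (1 - fps_X ^ 2)"
  define F1 where "F1 = fps_X * wm / wp"
  have g0: "g $ 0 \<noteq> 0"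
    using assms(1) by (simp add: fps_class_def)
  have wp0: "wp $ 0 = g $ 0" and wm0: "wm $ 0 = - g $ 0"
    by (simp_all add: wp_def wm_def)
  have div_v: "a / (1 - fps_X ^ 2) = a * v" for a :: "complex fps"
    by (simp add: v_def fps_divide_unit)
  have v0: "v $ 0 = 1"
    by (simp add: v_def)
  have G: "G = wp * v"
    by (simp add: G_def divide_one_minus_X div_v wp_def algebra_simps)
  have F1: "F1 = fps_X * (wm * inverse wp)"
    using wp0 g0 by (simp add: F1_def fps_divide_unit mult.assoc)
  have GF1: "G * F1 = fps_X * (wm * v)"
  proof -
    have "G * F1 = fps_X * (wm * v) * (inverse wp * wp)"
      by (simp add: G F1 mult_ac)
    then show ?thesis
      using wp0 g0 by (simp add: inverse_mult_eq_1)
  qed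
  have array: "sprugnoli_array G F1 fps_X"
  proof -
    have "odd_fps fps_X"
      unfolding odd_fps_def by (rule exI[of _ 1]) simp
    then show ?thesis
      using g0 by (simp add: sprugnoli_array_def fps_class_def G F1 wp0 wm0 v0)
  qed
  have "M n k = sprugnoli_matrix G F1 fps_X n k" for n k
  proof -
    have "B_gf g f $ k = fps_X ^ k * ((fps_X * f + (- 1) ^ k * ((1 + fps_X) * g)) * v)"
      by (simp add: B_gf_column divide_one_minus_X div_v power_minus[of fps_X] algebra_simps)
    also have "\<dots> = G * F1 ^ (k mod 2) * (fps_X * fps_X) ^ (k div 2)"
    proof (cases "even k")
      case True
      then obtain m where "k = 2 * m" ..
      then show ?thesis
        by (simp add: G wp_def power_mult power2_eq_square power_mult_distrib mult_ac)
    next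
      case False
      then obtain m where m: "k = 2 * m + 1" ..
      then have "k mod 2 = 1" "k div 2 = m"
        by simp_all
      moreover have "fps_X * f + (- 1) ^ k * ((1 + fps_X) * g) = wm"
        by (simp add: m wm_def)
      moreover have "fps_X ^ k = fps_X * (fps_X * fps_X :: complex fps) ^ m"
        by (simp add: m power_mult power2_eq_square)
      ultimately show ?thesis
        by (simp only: GF1 power_one_right) (simp only: mult_ac)
    qed
    finally have "B_gf g f $ k $ n = sprugnoli_matrix G F1 fps_X n k"
      by (simp only: sprugnoli_matrix_def)
    then show ?thesis
      by (simp add: assms(3)[symmetric] bivariate_gf_def)
  qed
  then have "M = sprugnoli_matrix G F1 fps_X"
    by (intro ext)
  with array show ?thesis
    by (simp only: G_def F1_def wp_def wm_def)
qed

end
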